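(* Let $(x,y)\in\mathbb{R}^2$ and $r\in\mathbb{R}$, $r\neq 0$, satisfy $$\Big(0<y\land r\le \tfrac{x^2+y^2}{2y}\Big)\ \lor\ (y=0\land x<0)\ \lor\ \Big(y<0\land \tfrac{x^2+y^2}{2y}\le r\Big).$$ Let $\theta=\Theta(x,y,r)$. Then a vehicle following a turn-to-bearing trajectory can approach $(x,y)$ using a turn of radius $r$ with approach angle $\theta$; that is, $0<r\theta<2\pi|r|$ and there is $d\ge r\theta$ with $H_{r,\theta}(d)=(x,y)$.
   Context: Turn-to-bearing paths in standard position: start at the origin heading in the $+x$ direction. For a signed radius $r\neq0$ ($r>0$ left/counterclockwise, $r<0$ right/clockwise) and signed bearing offset $\theta_c$ with $0<r\theta_c<2\pi|r|$, define for $d\ge0$: $H_{r,\theta_c}(d)=(r\sin(d/r),\ r(1-\cos(d/r)))$ if $d\le r\theta_c$, and $H_{r,\theta_c}(d)=((d-r\theta_c)\cos\theta_c+r\sin\theta_c,\ (d-r\theta_c)\sin\theta_c+r(1-\cos\theta_c))$ if $d>r\theta_c$. Approach angle function ($\mathrm{atan}$ is the one-argument arctangent with values in $(-\pi/2,\pi/2)$, $\mathrm{sign}$ the sign function): $\Theta(x,y,r)=2\,\mathrm{atan}\!\Big(\dfrac{x-\sqrt{x^2-(2r-y)y}}{2r-y}\Big)+P(x,y,r)$ if $2r-y\ne0$; $\Theta(x,y,r)=2\,\mathrm{atan}\big(\tfrac{y}{2x}\big)$ if $2r-y=0$ and $x>0$; $\Theta(x,y,r)=\pi\,\mathrm{sign}(r)$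 if $2r-y=0$ and $x\le0$. Phase correction: $P(x,y,r)=0$ if $\big(0<r\land((0<x\land0<y)\lor(x\le0\land 2r<y))\big)\lor\big(r<0\land((x<0\land y<0)\lor y<2r)\big)$; $P(x,y,r)=2\pi$ if $0<r\land((0\le x\land y<0)\lor(x<0\land y<2r))$; $P(x,y,r)=-2\pi$ if $r<0\land((0\le x\land 0<y)\lor(x<0\land 2r<y))$.
   Formalization: In the zero clause of P for r<0, the printed condition x<0 ∧ y<0 is replaced by 0<x ∧ y<0, since the printed P has two conflicting values when r<0, x<0, 2r<y<0 and none when r<0, 0<x, 2r<y<0. *)

theory Defs
  imports Complex_Main
begin

text \<open>Position after travelled distance \<open>d\<close>: first along the arc of signed radius \<open>r\<close>, of length
  \<open>r * \<theta>\<close>, then along the tangent line with bearing \<open>\<theta>\<close>.  Meaningful for \<open>d \<ge> 0\<close>, \<open>r \<noteq> 0\<close> and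
  \<open>0 < r * \<theta> < 2 * pi * \<bar>r\<bar>\<close>.\<close>

definition turn_path :: "real \<Rightarrow> real \<Rightarrow> real \<Rightarrow> real \<times> real" where
  "turn_path r \<theta> d =
    (if d \<le> r * \<theta>
     then (r * sin (d / r), r * (1 - cos (d / r)))
     else ((d - r * \<theta>) * cos \<theta> + r * sin \<theta>,
           (d - r * \<theta>) * sin \<theta> + r * (1 - cos \<theta>)))"

text \<open>The conditions are mutually exclusive.  They do not cover the whole space, so the value
  elsewhere is left unspecified.  Caution: in the first condition, the source prints \<open>x < 0 \<and> y < 0\<close>
  for \<open>r < 0\<close>, where \<open>0 < x \<and> y < 0\<close> is used here.  The printed version is a misprint: for
  \<open>x < 0\<close> and \<open>2 * r < y < 0\<close> it overlaps with the condition for \<open>-2 * pi\<close>, and it leaves the region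
  \<open>0 < x\<close>, \<open>2 * r < y < 0\<close> without a value.  The version below is the mirror image, under
  \<open>(y, r) \<mapsto> (-y, -r)\<close>, of the condition for \<open>0 < r\<close>; whenever \<open>y \<noteq> 2 * r\<close>, it gives the printed value
  wherever exactly one of the printed conditions holds.\<close>

definition phase_correction :: "real \<Rightarrow> real \<Rightarrow> real \<Rightarrow> real" where
  "phase_correction x y r =
    (if (0 < r \<and> ((0 < x \<and> 0 < y) \<or> (x \<le> 0 \<and> 2 * r < y))) \<or>
        (r < 0 \<and> ((0 < x \<and> y < 0) \<or> y < 2 * r)) then 0
     else if 0 < r \<and> ((0 \<le> x \<and> y < 0) \<or> (x < 0 \<and> y < 2 * r)) then 2 * pi
     else if r < 0 \<and> ((0 \<le> x \<and> 0 < y) \<or> (x < 0 \<and> 2 * r < y)) then - 2 * pi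
     else undefined)"

definition approach_angle :: "real \<Rightarrow> real \<Rightarrow> real \<Rightarrow> real" where
  "approach_angle x y r =
    (if 2 * r - y \<noteq> 0
     then 2 * arctan ((x - sqrt (x\<^sup>2 - (2 * r - y) * y)) / (2 * r - y)) + phase_correction x y r
     else if 0 < x then 2 * arctan (y / (2 * x))
     else pi * sgn r)"

end

theory Submission
  imports Defs
begin

text \<open>Write \<open>L\<close> for the length of the tangent from \<open>(x, y)\<close> to the turning circle with centre
  \<open>(0, r)\<close>, so \<open>L\<^sup>2 = x\<^sup>2 - (2 * r - y) * y\<close>.  The path reaches \<open>(x, y)\<close> after travelling \<open>L\<close> beyond
  the arc, and in terms of \<open>t = tan (\<theta> / 2)\<close> the two coordinate equations reduce to
  \<open>t * (2 * r - y) = x - L\<close> and \<open>t * (x + L) = y\<close>.  The sign of \<open>t\<close> can be read off the second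
  equation for \<open>0 < x\<close> and off the first for \<open>x \<le> 0\<close>; the phase correction is what moves
  \<open>2 * arctan t\<close> into the full turn in the direction of \<open>r\<close>.\<close>

text \<open>For \<open>L = 0\<close> the definition selects the arc branch, which at its endpoint
  agrees with the tangent formula.\<close>

lemma turn_path_tangent:
  assumes "r \<noteq> 0" "0 \<le> L"
  shows "turn_path r \<theta> (r * \<theta> + L) =
    (L * cos \<theta> + r * sin \<theta>, L * sin \<theta> + r * (1 - cos \<theta>))"
  using assms by (auto simp: turn_path_def)

lemma cos_double_arctan: "cos (2 * arctan t) = (1 - t\<^sup>2) / (1 + t\<^sup>2)"
proof -
  have "1 + t\<^sup>2 > 0" by (simp add: add_pos_nonneg)
  then show ?thesis
    by (simp add: cos_double cos_arctan sin_arctan power_divide diff_divide_distrib)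
qed

lemma sin_double_arctan: "sin (2 * arctan t) = 2 * t / (1 + t\<^sup>2)"
proof -
  have "1 + t\<^sup>2 > 0" by (simp add: add_pos_nonneg)
  then show ?thesis
    by (simp add: sin_double cos_arctan sin_arctan)
qed

text \<open>\<open>\<theta>\<close> enters only through \<open>cos\<close> and \<open>sin\<close>,
  so that it may differ from \<open>2 * arctan t\<close> by a full turn.\<close>

lemma half_angle_tangent_point:
  fixes x y r L t :: real
  assumes "t * (2 * r - y) = x - L" "t * (x + L) = y"
    and "cos \<theta> = cos (2 * arctan t)" "sin \<theta> = sin (2 * arctan t)"
  shows "L * cos \<theta> + r * sin \<theta> = x" "L * sin \<theta> + r * (1 - cos \<theta>) = y"
proof -
  have "1 + t\<^sup>2 > 0" by (simp add: add_pos_nonneg)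
  then have "1 + t\<^sup>2 \<noteq> 0"
    and "cos \<theta> * (1 + t\<^sup>2) = 1 - t\<^sup>2" "sin \<theta> * (1 + t\<^sup>2) = 2 * t"
    by (simp_all add: assms(3,4) cos_double_arctan sin_double_arctan)
  then show "L * cos \<theta> + r * sin \<theta> = x" "L * sin \<theta> + r * (1 - cos \<theta>) = y"
    using assms(1,2) by algebra+
qed

text \<open>When \<open>r * t\<close> is negative, \<open>2 * arctan t\<close> turns against the
  sign of \<open>r\<close>, and one full turn must be added.\<close>

lemma phase_correction_half_angle:
  fixes x y r L t :: real
  assumes "r \<noteq> 0" "2 * r \<noteq> y" "0 \<le> L" "L\<^sup>2 = x\<^sup>2 - (2 * r - y) * y"
    and "y \<noteq> 0 \<or> x < 0"
    and "t * (2 * r - y) = x - L" "t * (x + L) = y"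
  shows "(0 < r * t \<and> phase_correction x y r = 0) \<or>
         (r * t < 0 \<and> phase_correction x y r = 2 * pi * sgn r)"
proof (cases "0 < x")
  case True
  then have "0 < x + L" "y \<noteq> 0" using assms by auto
  then have "0 < t \<longleftrightarrow> 0 < y" "t < 0 \<longleftrightarrow> y < 0"
    using assms(7) by (metis mult_less_0_iff zero_less_mult_iff less_asym)+
  with True \<open>y \<noteq> 0\<close> \<open>r \<noteq> 0\<close> show ?thesis
    by (auto simp: phase_correction_def zero_less_mult_iff mult_less_0_iff sgn_if)
next
  case False
  \<comment> \<open>At \<open>x = 0\<close>, \<open>L\<^sup>2 = (y - 2 * r) * y\<close> has two
    nonzero factors.\<close>
  have "x < 0 \<or> 0 < L"
    using False assms(2-5) by (cases "x = 0") (auto simp: less_le)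
  then have "x - L < 0" using False assms(3) by linarith
  then have sgns: "0 < t \<longleftrightarrow> 2 * r < y" "t < 0 \<longleftrightarrow> y < 2 * r"
    using assms(6) by (smt (verit) mult_less_0_iff)+
  \<comment> \<open>On the axis \<open>x = 0\<close>, points with \<open>y\<close> between
    \<open>0\<close> and \<open>2 * r\<close> would get an undefined correction; they lie inside the
    circle, where \<open>L\<^sup>2\<close> would be negative.\<close>
  have axis: "y < 0 \<or> 2 * r < y" if "x = 0" "0 < r"
    using that assms(2-5) by (smt (verit) mult_pos_pos zero_le_power2 zero_power2)
  have axis': "0 < y \<or> y < 2 * r" if "x = 0" "r < 0"
    using that assms(2-5) by (smt (verit) mult_neg_neg zero_le_power2 zero_power2)
  consider "0 < r" "2 * r < y" | "0 < r" "y < 2 * r" | "r < 0" "2 * r < y" | "r < 0" "y < 2 * r"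
    using assms(1,2) by linarith
  then show ?thesis
    using False sgns axis axis'
    by cases (auto simp: phase_correction_def zero_less_mult_iff mult_less_0_iff sgn_if)
qed

lemma full_turn_half_angle:
  assumes "r \<noteq> 0"
    and "(0 < r * t \<and> p = 0) \<or> (r * t < 0 \<and> p = 2 * pi * sgn r)"
  shows "0 < r * (2 * arctan t + p)" "r * (2 * arctan t + p) < 2 * pi * \<bar>r\<bar>"
proof -
  have bound: "- (pi / 2) < arctan t" "arctan t < pi / 2"
    by (rule arctan_lbound, rule arctan_ubound)
  \<comment> \<open>Normalised by \<open>sgn r\<close>, the angle lies in (0, pi) if
    \<open>p = 0\<close> and in (pi, 2 pi) otherwise.\<close>
  have "0 < sgn r * (2 * arctan t + p) \<and> sgn r * (2 * arctan t + p) < 2 * pi"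
    using assms bound by (auto simp: zero_less_mult_iff mult_less_0_iff)
  moreover have "r * (2 * arctan t + p) = \<bar>r\<bar> * (sgn r * (2 * arctan t + p))"
    by (metis mult.assoc mult.commute mult_sgn_abs)
  ultimately show "0 < r * (2 * arctan t + p)" "r * (2 * arctan t + p) < 2 * pi * \<bar>r\<bar>"
    using assms(1) by (simp_all only: zero_less_mult_iff mult.commute[of "2 * pi"]
        mult_less_cancel_left_pos zero_less_abs_iff simp_thms)
qed

theorem theorem2:
  fixes x y r \<theta> :: real
  assumes "r \<noteq> 0"
    and "(0 < y \<and> r \<le> (x\<^sup>2 + y\<^sup>2) / (2 * y)) \<or>
         (y = 0 \<and> x < 0) \<or>
         (y < 0 \<and> (x\<^sup>2 + y\<^sup>2) / (2 * y) \<le> r)"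
    and "\<theta> = approach_angle x y r"
  shows "0 < r * \<theta> \<and> r * \<theta> < 2 * pi * \<bar>r\<bar> \<and>
         (\<exists>d. r * \<theta> \<le> d \<and> turn_path r \<theta> d = (x, y))"
proof -
  define L where "L = sqrt (x\<^sup>2 - (2 * r - y) * y)"
  \<comment> \<open>Clearing \<open>2 * y\<close> turns the hypothesis into: the point is not inside
    the turning circle.\<close>
  have "0 \<le> x\<^sup>2 - (2 * r - y) * y"
    using assms(2) by (auto simp: field_simps power2_eq_square)
  then have L: "0 \<le> L" "L\<^sup>2 = x\<^sup>2 - (2 * r - y) * y"
    by (simp_all add: L_def)
  have region: "y \<noteq> 0 \<or> x < 0" using assms(2) by auto
  have "0 < r * \<theta> \<and> r * \<theta> < 2 * pi * \<bar>r\<bar> \<and>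
    L * cos \<theta> + r * sin \<theta> = x \<and> L * sin \<theta> + r * (1 - cos \<theta>) = y"
  proof -
    consider "2 * r \<noteq> y" | "y = 2 * r" "0 < x" | "y = 2 * r" "x \<le> 0" by linarith
    then show ?thesis
    proof cases
      case 1
      define t where "t = (x - L) / (2 * r - y)"
      let ?p = "phase_correction x y r"
      have \<theta>: "\<theta> = 2 * arctan t + ?p"
        using 1 assms(3) by (simp add: approach_angle_def t_def L_def)
      have t1: "t * (2 * r - y) = x - L" using 1 by (simp add: t_def)
      have "(x - L) * (x + L) = (2 * r - y) * y"
        using L(2) by algebra
      then have t2: "t * (x + L) = y" using 1 by (simp add: t_def)
      note p = phase_correction_half_angle[OF assms(1) 1 L region t1 t2]
      have "?p = 0 \<or> ?p = 2 * pi \<or> ?p = - (2 * pi)"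
        using p by (auto simp: sgn_if split: if_splits)
      then have "cos \<theta> = cos (2 * arctan t)" "sin \<theta> = sin (2 * arctan t)"
        by (auto simp: \<theta> cos_add sin_add)
      with half_angle_tangent_point[OF t1 t2] full_turn_half_angle[OF assms(1) p]
      show ?thesis by (simp add: \<theta>)
    next
      case 2
      \<comment> \<open>Here \<open>L = x\<close> and the first equation reads 0 = 0, so
        \<open>t\<close> comes from the second.\<close>
      define t where "t = y / (2 * x)"
      have \<theta>: "\<theta> = 2 * arctan t"
        using 2 assms(3) by (simp add: approach_angle_def t_def)
      have "L = x" using 2 by (simp add: L_def)
      then have t: "t * (2 * r - y) = x - L" "t * (x + L) = y"
        using 2 by (simp_all add: t_def)
      have "r * t = r\<^sup>2 / x" using 2 by (simp add: t_def power2_eq_square)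
      then have "0 < r * t" using 2 assms(1) by simp
      then show ?thesis
        using half_angle_tangent_point[OF t] full_turn_half_angle[OF assms(1), of t 0]
        by (simp add: \<theta>)
    next
      case 3
      \<comment> \<open>A half turn has no finite \<open>tan (\<theta> / 2)\<close>, so the
        coordinates are checked directly.\<close>
      have "\<theta> = pi * sgn r" using 3 assms(3) by (simp add: approach_angle_def)
      moreover have "L = - x" using 3 by (simp add: L_def)
      ultimately show ?thesis using 3 assms(1)
        by (auto simp: sgn_if mult_less_0_iff)
    qed
  qed
  then show ?thesis
    using turn_path_tangent[OF assms(1) L(1), of \<theta>] L(1)
    by (intro conjI exI[of _ "r * \<theta> + L"]) auto
qed

end
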